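(* For every $n\ge 2$, $f_4(n)\le \lceil\log_2 n\rceil+\lceil\log_2\log_2 n\rceil+2$.
   Context: Model 4 (adaptive, three players $A,B,C$). $X$ is an $n$-element set of distinguishable elements and Player $A$ (the adversary) chooses an unknown defective element $d\in X$. Players $B$ and $C$ may agree on a (deterministic) questioning strategy before the process starts, but cannot communicate afterwards except through the rules below. At each step Player $A$ decides which of $B$ and $C$ asks the next query; a query is a subset $Q\subseteq X$, whose answer is YES iff $d\in Q$. The player asking a query obtains no information about its answer. If the answer to a query asked by $B$ is YES, then $C$ learns the query set and that the answer was YES; similarly if the answer to a query asked by $C$ is YES, then $B$ learns the query set and that the answer was YES. If the answer is NO, the other player learns nothing (not even that a query was asked). Each player's queries may depend only on the information that player has. The goal is that at least one of $B$ and $C$ can identify $d$ (i.e. $d$ is the only element consistent with that player's information). $f_4(n)$ is the minimum $N$ such that $B$ and $C$ have a strategy guaranteeing that, whatever $d$ and whatever order of questioners $A$ chooses, the goal is reached after at most $N$ queries in total. *)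

theory Defs
  imports Complex_Main
begin

datatype player = PlayerB | PlayerC

text \<open>What a player experiences: asking a query (without seeing its answer), or being told
  a query of the other player that was answered YES. A NO leaves no trace with the other player.\<close>

datatype 'a event = Asked "'a set" | HeardYes "'a set"

text \<open>A view is the chronological list of a player's own events. There is no clock in it,
  so a player cannot notice queries of the other player that were answered NO.\<close>

type_synonym 'a view = "'a event list"

type_synonym 'a strategy = "player \<Rightarrow> 'a view \<Rightarrow> 'a set"

text \<open>\<open>views s d ord k p\<close> is the view of player \<open>p\<close> after \<open>k\<close> queries, when the defective
  element is \<open>d\<close> and the adversary lets \<open>ord i\<close> ask query number \<open>i\<close> (counted from 0).
  Everything else being deterministic, an adversary who reacts to the course of the game is
  also described by such a sequence.\<close>

primrec views :: "'a strategy \<Rightarrow> 'a \<Rightarrow> (nat \<Rightarrow> player) \<Rightarrow> nat \<Rightarrow> player \<Rightarrow> 'a view" where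
  "views s d ord 0 = (\<lambda>p. [])"
| "views s d ord (Suc k) =
    (let v = views s d ord k; Q = s (ord k) (v (ord k))
     in (\<lambda>p. if p = ord k then v p @ [Asked Q]
             else if d \<in> Q then v p @ [HeardYes Q]
             else v p))"

text \<open>The strategy is common knowledge, hence an element is consistent with a view if it could
  have led to this view under some order of questioners and after some number of queries.\<close>

definition consistent :: "'a set \<Rightarrow> 'a strategy \<Rightarrow> player \<Rightarrow> 'a view \<Rightarrow> 'a set" where
  "consistent X s p v = {d \<in> X. \<exists>ord k. views s d ord k p = v}"

definition succeeds_within :: "'a set \<Rightarrow> 'a strategy \<Rightarrow> nat \<Rightarrow> bool" where
  "succeeds_within X s N \<longleftrightarrow>
    (\<forall>d\<in>X. \<forall>ord. \<exists>k\<le>N. \<exists>p. consistent X s p (views s d ord k p) = {d})"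

definition solvable_within :: "'a set \<Rightarrow> nat \<Rightarrow> bool" where
  "solvable_within X N \<longleftrightarrow> (\<exists>s. (\<forall>p v. s p v \<subseteq> X) \<and> succeeds_within X s N)"

definition f4 :: "nat \<Rightarrow> nat" where
  "f4 n = (LEAST N. solvable_within {..<n} N)"

text \<open>The minimum is over a nonempty set: let both players ask all singletons in turn.\<close>

lemma HeardYes_sound: "HeardYes Q \<in> set (views s d ord k p) \<Longrightarrow> d \<in> Q"
  by (induction k) (auto simp: Let_def split: if_splits)

lemma HeardYes_if_Asked:
  "Asked Q \<in> set (views s d ord k p) \<Longrightarrow> d \<in> Q \<Longrightarrow> q \<noteq> p \<Longrightarrow> HeardYes Q \<in> set (views s d ord k q)"
proof (induction k)
  case (Suc k)
  have "q = ord k \<or> p = ord k"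
    using \<open>q \<noteq> p\<close> by (cases p; cases q; cases "ord k") auto
  with Suc show ?case by (auto simp: Let_def split: if_splits)
qed simp

definition own_queries :: "'a view \<Rightarrow> nat" where
  "own_queries v = length (filter (\<lambda>e. case e of Asked Q \<Rightarrow> True | HeardYes Q \<Rightarrow> False) v)"

lemma own_queries_views:
  "own_queries (views s d ord k PlayerB) + own_queries (views s d ord k PlayerC) = k"
proof (induction k)
  case (Suc k)
  then show ?case
    by (cases "ord k") (auto simp: Let_def own_queries_def)
qed (simp add: own_queries_def)

lemma Asked_singleton:
  assumes "i < own_queries (views (\<lambda>p v. {own_queries v} \<inter> {..<n}) d ord k p)" and "i < n"
  shows "Asked {i} \<in> set (views (\<lambda>p v. {own_queries v} \<inter> {..<n}) d ord k p)"
  using assms(1)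
proof (induction k)
  case (Suc k)
  let ?v = "views (\<lambda>p v. {own_queries v} \<inter> {..<n}) d ord k p"
  show ?case
  proof (cases "i < own_queries ?v")
    case True
    with Suc.IH show ?thesis by (auto simp: Let_def)
  next
    case False
    with Suc.prems have "p = ord k \<and> i = own_queries ?v"
      by (auto simp: Let_def own_queries_def split: if_splits)
    with \<open>i < n\<close> show ?thesis by (auto simp: Let_def)
  qed
qed (simp add: own_queries_def)

lemma solvable_within_exists: "\<exists>N. solvable_within {..<n::nat} N"
proof -
  define s :: "nat strategy" where "s = (\<lambda>p v. {own_queries v} \<inter> {..<n})"
  have "\<exists>k\<le>2 * n. \<exists>p. consistent {..<n} s p (views s d ord k p) = {d}" if d: "d < n" for d ord
  proof -
    have "own_queries (views s d ord (2 * n) PlayerB)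
        + own_queries (views s d ord (2 * n) PlayerC) = 2 * n"
      by (rule own_queries_views)
    then have "n \<le> own_queries (views s d ord (2 * n) PlayerB)
        \<or> n \<le> own_queries (views s d ord (2 * n) PlayerC)"
      by linarith
    then obtain p where "n \<le> own_queries (views s d ord (2 * n) p)"
      by blast
    with d have "Asked {d} \<in> set (views s d ord (2 * n) p)"
      unfolding s_def by (intro Asked_singleton) auto
    moreover obtain q where "q \<noteq> p"
      by (metis player.distinct(1))
    ultimately have "HeardYes {d} \<in> set (views s d ord (2 * n) q)"
      by (intro HeardYes_if_Asked) auto
    then have "consistent {..<n} s q (views s d ord (2 * n) q) = {d}"
      using d HeardYes_sound[of "{d}" s] unfolding consistent_def
      by (auto, metis singletonD)
    then show ?thesis by blast
  qed
  then have "succeeds_within {..<n} s (2 * n)"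
    by (simp add: succeeds_within_def)
  moreover have "\<forall>p v. s p v \<subseteq> {..<n}"
    by (simp add: s_def)
  ultimately show ?thesis
    unfolding solvable_within_def by blast
qed

end

theory Submission
  imports Defs
begin

text \<open>
  Encode the elements of \<open>X\<close> by an antichain of subsets of \<open>{..<N}\<close>. Player \<open>B\<close> asks for the
  positions \<open>0, 1, 2, \<dots>\<close> of the code of \<open>d\<close> and player \<open>C\<close> for \<open>N - 1, N - 2, \<dots>\<close>, but every
  query is intersected with all sets of which the asker has heard that they contain \<open>d\<close>. This
  does not change the answer, yet a YES passes on everything the asker has heard. Since a player
  hears every YES of the other player, the one who hears the last YES knows all positions asked so
  far that belong to the code of \<open>d\<close>. After \<open>N\<close> queries all positions have been asked, and by the
  antichain property the code of \<open>d\<close> is the only one containing these positions. Sperner's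
  antichain of the sets of size \<open>N div 2\<close> has at least \<open>2 ^ N / (N + 1)\<close> members, which is enough
  for the claimed \<open>N\<close>.
\<close>

text \<open>With no YES heard this is \<open>UNIV\<close>, so it then excludes nothing.\<close>

definition heard :: "'a view \<Rightarrow> 'a set" where
  "heard v = \<Inter> {Q. HeardYes Q \<in> set v}"

lemma heard_append_Asked [simp]: "heard (v @ [Asked Q]) = heard v"
  by (simp add: heard_def)

lemma heard_append_HeardYes [simp]: "heard (v @ [HeardYes Q]) = heard v \<inter> Q"
  by (auto simp: heard_def)

lemma own_queries_append_Asked [simp]: "own_queries (v @ [Asked Q]) = Suc (own_queries v)"
  by (simp add: own_queries_def)

lemma own_queries_append_HeardYes [simp]: "own_queries (v @ [HeardYes Q]) = own_queries v"
  by (simp add: own_queries_def)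

lemma mem_heard_views: "d \<in> heard (views s d ord k p)"
  by (auto simp: heard_def dest: HeardYes_sound)

definition relay_strategy :: "'a set \<Rightarrow> ('a \<Rightarrow> 'i set) \<Rightarrow> (player \<Rightarrow> nat \<Rightarrow> 'i) \<Rightarrow> 'a strategy" where
  "relay_strategy X code pos p v = {x \<in> X. pos p (own_queries v) \<in> code x} \<inter> heard v"

definition asked_positions :: "(player \<Rightarrow> nat \<Rightarrow> 'i) \<Rightarrow> player \<Rightarrow> 'a view \<Rightarrow> 'i set" where
  "asked_positions pos p v = pos p ` {..<own_queries v}"

lemma asked_positions_append [simp]:
  "asked_positions pos p (v @ [Asked Q]) =
     insert (pos p (own_queries v)) (asked_positions pos p v)"
  "asked_positions pos p (v @ [HeardYes Q]) = asked_positions pos p v"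
  by (auto simp: asked_positions_def lessThan_Suc)

lemma mem_relay_strategy_iff:
  assumes "d \<in> X"
  shows "d \<in> relay_strategy X code pos p (views s d ord k p) \<longleftrightarrow>
    pos p (own_queries (views s d ord k p)) \<in> code d"
  using assms mem_heard_views by (auto simp: relay_strategy_def)

text \<open>Each position of \<open>code d\<close> that \<open>q\<close> asks gets a YES, so
  \<open>p\<close> hears that query, and all its members have this position in their code. Positions
  outside \<open>code d\<close> impose nothing.\<close>

lemma heard_relay_other:
  assumes "d \<in> X" "p \<noteq> q"
    and "x \<in> heard (views (relay_strategy X code pos) d ord k p)"
  shows "asked_positions pos q (views (relay_strategy X code pos) d ord k q) \<inter> code d \<subseteq> code x"
  using assms(3)
proof (induction k)
  case 0
  then show ?case by (simp add: asked_positions_def own_queries_def)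
next
  case (Suc k)
  let ?s = "relay_strategy X code pos"
  let ?v = "views ?s d ord k"
  note iff = mem_relay_strategy_iff[OF assms(1), of code pos q ?s ord k]
  show ?case
  proof (cases "ord k = q")
    case True
    have IH: "asked_positions pos q (?v q) \<inter> code d \<subseteq> code x"
      using Suc True assms(2) by (auto simp: Let_def split: if_splits)
    show ?thesis
    proof (cases "d \<in> ?s q (?v q)")
      case yes: True
      then have "x \<in> ?s q (?v q)"
        using Suc.prems True assms(2) by (simp add: Let_def)
      then have "pos q (own_queries (?v q)) \<in> code x"
        by (simp add: relay_strategy_def)
      with IH True show ?thesis by (auto simp: Let_def)
    next
      case False
      with iff IH True show ?thesis by (auto simp: Let_def)
    qed
  next
    case False
    with assms(2) have "ord k = p"
      by (cases "ord k"; cases p; cases q) auto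
    with Suc assms(2) show ?thesis by (auto simp: Let_def split: if_splits)
  qed
qed

text \<open>The witness \<open>p\<close> is the player who heard the latest YES; until the first YES
  either player will do.\<close>

lemma heard_relay_last:
  assumes "d \<in> X"
  shows "\<exists>p. \<forall>x \<in> heard (views (relay_strategy X code pos) d ord k p). \<forall>q.
    asked_positions pos q (views (relay_strategy X code pos) d ord k q) \<inter> code d \<subseteq> code x"
proof (induction k)
  case 0
  then show ?case by (simp add: asked_positions_def own_queries_def)
next
  case (Suc k)
  let ?s = "relay_strategy X code pos"
  let ?v = "views ?s d ord k"
  let ?Q = "?s (ord k) (?v (ord k))"
  note iff = mem_relay_strategy_iff[OF assms, of code pos "ord k" ?s ord k]
  show ?case
  proof (cases "d \<in> ?Q")
    case False
    \<comment> \<open>A NO adds only a position outside \<open>code d\<close> and is not heard, so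
      the old witness remains valid.\<close>
    then have "asked_positions pos q (views ?s d ord (Suc k) q) \<inter> code d
        = asked_positions pos q (?v q) \<inter> code d"
      and "heard (views ?s d ord (Suc k) q) = heard (?v q)" for q
      using iff by (auto simp: Let_def)
    with Suc show ?thesis by simp
  next
    case True
    obtain p where p: "p \<noteq> ord k"
      by (metis player.distinct(1))
    have "asked_positions pos q (views ?s d ord (Suc k) q) \<inter> code d \<subseteq> code x"
      if x: "x \<in> heard (views ?s d ord (Suc k) p)" for x q
    proof (cases "q = p")
      case True
      \<comment> \<open>The query just heard lies inside what its asker had heard, so
        \<open>x\<close> also passes all that the asker knew about the positions asked by
        \<open>p\<close>.\<close>
      have "x \<in> heard (?v (ord k))"
        using x p \<open>d \<in> ?Q\<close> by (simp add: Let_def relay_strategy_def)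
      then have "asked_positions pos p (?v p) \<inter> code d \<subseteq> code x"
        using heard_relay_other[OF assms] p by metis
      with p True \<open>d \<in> ?Q\<close> show ?thesis by (simp add: Let_def)
    next
      case False
      with heard_relay_other[OF assms, of p q] x show ?thesis by blast
    qed
    then show ?thesis by blast
  qed
qed

text \<open>A NO is never learnt, so an element \<open>x\<close> consistent with the view is only
  known to satisfy \<open>code d \<subseteq> code x\<close>; hence codes must be incomparable, not
  merely distinct.\<close>

lemma solvable_within_antichain_code:
  fixes code :: "'a \<Rightarrow> nat set"
  assumes code: "\<And>x. x \<in> X \<Longrightarrow> code x \<subseteq> {..<N}"
    and antichain: "\<And>x y. x \<in> X \<Longrightarrow> y \<in> X \<Longrightarrow> code x \<subseteq> code y \<Longrightarrow> x = y"
  shows "solvable_within X N"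
proof -
  \<comment> \<open>Counting from opposite ends, \<open>b\<close> queries by \<open>B\<close> and
    \<open>N - b\<close> by \<open>C\<close> cover \<open>{..<N}\<close> exactly once, whatever the
    order and without a common clock.\<close>
  define pos where "pos p j = (case p of PlayerB \<Rightarrow> j | PlayerC \<Rightarrow> N - 1 - j)" for p and j :: nat
  let ?s = "relay_strategy X code pos"
  have ex: "\<exists>p. consistent X ?s p (views ?s d ord N p) = {d}" if d: "d \<in> X" for d ord
  proof -
    let ?v = "views ?s d ord N"
    obtain p where p: "\<forall>x \<in> heard (?v p). \<forall>q.
        asked_positions pos q (?v q) \<inter> code d \<subseteq> code x"
      using heard_relay_last[OF d] ..
    have all: "\<exists>q. i \<in> asked_positions pos q (?v q)" if "i < N" for i
    proof (cases "i < own_queries (?v PlayerB)")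
      case True
      then have "i \<in> asked_positions pos PlayerB (?v PlayerB)"
        by (simp add: asked_positions_def pos_def)
      then show ?thesis ..
    next
      case False
      with own_queries_views[of ?s d ord N] that have
        "N - 1 - i < own_queries (?v PlayerC)"
        by linarith
      moreover have "i = pos PlayerC (N - 1 - i)"
        using that by (simp add: pos_def)
      ultimately have "i \<in> asked_positions pos PlayerC (?v PlayerC)"
        unfolding asked_positions_def by (intro image_eqI[of _ _ "N - 1 - i"]) simp_all
      then show ?thesis ..
    qed
    have "x = d" if "x \<in> consistent X ?s p (?v p)" for x
    proof -
      \<comment> \<open>The run that makes \<open>x\<close> consistent may differ in order and
        length, but it yields the same view, and everything heard in it contains
        \<open>x\<close>.\<close>
      from that obtain ord' k where "x \<in> X" and "views ?s x ord' k p = ?v p"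
        unfolding consistent_def by blast
      then have "x \<in> X" "x \<in> heard (?v p)"
        using mem_heard_views[of x ?s ord' k p] by simp_all
      have "code d \<subseteq> code x"
      proof
        fix i
        assume i: "i \<in> code d"
        then obtain q where "i \<in> asked_positions pos q (?v q)"
          using all code[OF d] by blast
        with i p[rule_format, OF \<open>x \<in> heard (?v p)\<close>, of q] show "i \<in> code x"
          by blast
      qed
      with antichain[OF d \<open>x \<in> X\<close>] show ?thesis by simp
    qed
    moreover have "d \<in> consistent X ?s p (?v p)"
      using d unfolding consistent_def by blast
    ultimately show ?thesis by blast
  qed
  have "succeeds_within X ?s N"
    unfolding succeeds_within_def using ex by (intro ballI allI exI[of _ N] conjI) auto
  moreover have "?s p v \<subseteq> X" for p v
    by (auto simp: relay_strategy_def)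
  ultimately show ?thesis
    unfolding solvable_within_def by blast
qed

text \<open>Any injection into the \<open>w\<close>-subsets of \<open>{..<N}\<close> is an antichain
  code, since inclusion between finite sets of equal size is equality.\<close>

lemma solvable_within_binomial:
  assumes "finite X" "card X \<le> N choose w"
  shows "solvable_within X N"
proof -
  let ?W = "{S. S \<subseteq> {..<N} \<and> card S = w}"
  have "finite ?W" "card X \<le> card ?W"
    using assms(2) n_subsets[of "{..<N}" w] by auto
  then obtain code where code: "code ` X \<subseteq> ?W" "inj_on code X"
    using card_le_inj[OF assms(1)] by blast
  show ?thesis
  proof (rule solvable_within_antichain_code)
    fix x y
    assume xy: "x \<in> X" "y \<in> X" "code x \<subseteq> code y"
    then have "code y \<subseteq> {..<N}" "card (code x) = card (code y)"
      using code(1) by (simp_all add: image_subset_iff)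
    then have "code x = code y"
      using xy(3) by (intro card_subset_eq) (simp_all add: finite_subset)
    with code(2) xy(1,2) show "x = y"
      by (simp add: inj_on_eq_iff)
  qed (use code(1) in auto)
qed

text \<open>The \<open>N + 1\<close> coefficients of the row sum to \<open>2 ^ N\<close>, and the
  central one is the largest.\<close>

lemma two_power_le_central_binomial: "2 ^ N \<le> (N + 1) * (N choose (N div 2))"
proof -
  have "2 ^ N = (\<Sum>k\<le>N. N choose k)"
    by (simp add: choose_row_sum)
  also have "\<dots> \<le> (\<Sum>k\<le>N. N choose (N div 2))"
    by (intro sum_mono binomial_maximum)
  finally show ?thesis by simp
qed

theorem theorem4:
  fixes n :: nat
  assumes "n \<ge> 2"
  shows "int (f4 n) \<le> \<lceil>log 2 (real n)\<rceil> + \<lceil>log 2 (log 2 (real n))\<rceil> + 2"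
proof -
  define m where "m = nat \<lceil>log 2 (real n)\<rceil>"
  define l where "l = nat \<lceil>log 2 (log 2 (real n))\<rceil>"
  define N where "N = m + l + 2"
  \<comment> \<open>Both logarithms are nonnegative since \<open>n \<ge> 2\<close>, so
    \<open>nat\<close> truncates neither ceiling.\<close>
  have log1: "1 \<le> log 2 (real n)"
    using assms by simp
  then have log0: "0 \<le> log 2 (log 2 (real n))"
    by simp
  have m: "int m = \<lceil>log 2 (real n)\<rceil>" and l: "int l = \<lceil>log 2 (log 2 (real n))\<rceil>"
    unfolding m_def l_def using log1 log0 by linarith+
  have "real n \<le> 2 powr real m"
    using assms le_of_int_ceiling[of "log 2 (real n)"]
    by (simp add: le_powr_iff flip: m)
  then have n_le: "n \<le> 2 ^ m"
    by (simp add: powr_realpow)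
  have "log 2 (real n) \<le> 2 powr real l"
    using log1 le_of_int_ceiling[of "log 2 (log 2 (real n))"]
    by (simp add: le_powr_iff flip: l)
  then have "log 2 (real n) \<le> of_int (2 ^ l)"
    by (simp add: powr_realpow)
  then have "int m \<le> 2 ^ l"
    unfolding m by (rule ceiling_le)
  then have "m \<le> 2 ^ l"
    by simp
  moreover have "l < 2 ^ l"
    by simp
  \<comment> \<open>Here \<open>N + 1 = m + (l + 1) + 2\<close>, where \<open>m\<close> and
    \<open>l + 1\<close> are each at most \<open>2 ^ l\<close>, and
    \<open>2 \<le> 2 * 2 ^ l\<close>. The summand 2 in \<open>N\<close> supplies the factor
    4.\<close>
  ultimately have N_le: "N + 1 \<le> 4 * 2 ^ l"
    unfolding N_def by linarith
  have "(N + 1) * n \<le> (4 * 2 ^ l) * 2 ^ m"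
    using N_le n_le by (rule mult_le_mono)
  also have "\<dots> = 2 ^ N"
    by (simp add: N_def power_add)
  also have "\<dots> \<le> (N + 1) * (N choose (N div 2))"
    by (rule two_power_le_central_binomial)
  finally have "n \<le> N choose (N div 2)"
    by (simp only: mult_le_cancel1)
  then have "solvable_within {..<n} N"
    by (intro solvable_within_binomial) simp_all
  then have "f4 n \<le> N"
    unfolding f4_def by (rule Least_le)
  then show ?thesis
    using m l by (simp add: N_def)
qed

end
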